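(* Let $G$ be a connected graph of diameter $d$, and let $\mathcal{G}^k$ denote the family of all induced isometric subgraphs of $G$ of diameter $k$. Then for every $k\in\{1,2,\dots,d\}$, $$\mu_k(G)\ge \max\{\mu(H)\,:\,H\in\mathcal{G}^k\}.$$
   Context: All graphs are finite, simple, undirected and connected. For a graph $G$, a set $S\subseteq V(G)$ and an integer $k\ge 1$, two vertices $x,y$ are $S_k$-visible if there is a shortest $x,y$-path of length at most $k$ none of whose internal vertices lies in $S$. $S$ is a $k$-distance mutual-visibility set if every two vertices of $S$ are $S_k$-visible, and $\mu_k(G)$ is the maximum cardinality of such a set. Two vertices $x,y\in S$ are $S$-visible if there is a shortest $x,y$-path $P$ with $V(P)\cap S=\{x,y\}$; $S$ is a mutual-visibility set if every two vertices of $S$ are $S$-visible, and $\mu(G)$ (the mutual-visibility number) is the maximum cardinality of such a set. A subgraph $H$ of $G$ is isometric if $d_H(u,v)=d_G(u,v)$ for all $u,v\in V(H)$. *)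

theory Defs
  imports
    "Graph_Theory.Digraph_Component"
    "Graph_Theory.Vertex_Walk"
    "HOL-Library.Extended_Nat"
begin

text \<open>
  Finite simple undirected graphs are the instances of the locale \<^locale>\<open>graph\<close>: finite,
  symmetric digraphs without loops and parallel arcs, an edge being a pair of opposite arcs.
  Note that \<^const>\<open>connected\<close> entails that the vertex set is nonempty.
\<close>

definition path_between :: "('a, 'b) pre_digraph \<Rightarrow> 'a \<Rightarrow> 'a vwalk \<Rightarrow> 'a \<Rightarrow> bool" where
  "path_between G x p y \<longleftrightarrow> vpath p G \<and> hd p = x \<and> last p = y"

text \<open>The distance is \<open>\<infinity>\<close> if there is no path.\<close>

definition gdist :: "('a, 'b) pre_digraph \<Rightarrow> 'a \<Rightarrow> 'a \<Rightarrow> enat" where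
  "gdist G x y = (INF p \<in> {p. path_between G x p y}. enat (vwalk_length p))"

definition gdiameter :: "('a, 'b) pre_digraph \<Rightarrow> enat" where
  "gdiameter G = (SUP (x, y) \<in> verts G \<times> verts G. gdist G x y)"

definition shortest_path :: "('a, 'b) pre_digraph \<Rightarrow> 'a \<Rightarrow> 'a vwalk \<Rightarrow> 'a \<Rightarrow> bool" where
  "shortest_path G x p y \<longleftrightarrow> path_between G x p y \<and> enat (vwalk_length p) = gdist G x y"

definition internal_verts :: "'a vwalk \<Rightarrow> 'a set" where
  "internal_verts p = set p - {hd p, last p}"

definition k_visible :: "('a, 'b) pre_digraph \<Rightarrow> nat \<Rightarrow> 'a set \<Rightarrow> 'a \<Rightarrow> 'a \<Rightarrow> bool" where
  "k_visible G k S x y \<longleftrightarrow>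
    (\<exists>p. shortest_path G x p y \<and> vwalk_length p \<le> k \<and> internal_verts p \<inter> S = {})"

definition k_distance_mutual_visibility_set ::
    "('a, 'b) pre_digraph \<Rightarrow> nat \<Rightarrow> 'a set \<Rightarrow> bool" where
  "k_distance_mutual_visibility_set G k S \<longleftrightarrow>
    S \<subseteq> verts G \<and> (\<forall>x\<in>S. \<forall>y\<in>S. x \<noteq> y \<longrightarrow> k_visible G k S x y)"

definition mu_k :: "nat \<Rightarrow> ('a, 'b) pre_digraph \<Rightarrow> nat" where
  "mu_k k G = Max (card ` {S. k_distance_mutual_visibility_set G k S})"

definition visible :: "('a, 'b) pre_digraph \<Rightarrow> 'a set \<Rightarrow> 'a \<Rightarrow> 'a \<Rightarrow> bool" where
  "visible G S x y \<longleftrightarrow> (\<exists>p. shortest_path G x p y \<and> set p \<inter> S = {x, y})"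

definition mutual_visibility_set :: "('a, 'b) pre_digraph \<Rightarrow> 'a set \<Rightarrow> bool" where
  "mutual_visibility_set G S \<longleftrightarrow>
    S \<subseteq> verts G \<and> (\<forall>x\<in>S. \<forall>y\<in>S. x \<noteq> y \<longrightarrow> visible G S x y)"

definition mu :: "('a, 'b) pre_digraph \<Rightarrow> nat" where
  "mu G = Max (card ` {S. mutual_visibility_set G S})"

definition isometric_subgraph :: "('a, 'b) pre_digraph \<Rightarrow> ('a, 'b) pre_digraph \<Rightarrow> bool" where
  "isometric_subgraph H G \<longleftrightarrow>
    subgraph H G \<and> (\<forall>u\<in>verts H. \<forall>v\<in>verts H. gdist H u v = gdist G u v)"

text \<open>
  Connectedness of the members expresses the convention that all graphs are connected; for
  connected \<open>G\<close> it only excludes the null graph. Since \<^const>\<open>subgraph\<close> fixes the incidence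
  functions of \<open>H\<close> to be those of \<open>G\<close>, the family is finite for finite \<open>G\<close>.
\<close>

definition induced_isometric_subgraphs ::
    "('a, 'b) pre_digraph \<Rightarrow> nat \<Rightarrow> ('a, 'b) pre_digraph set" where
  "induced_isometric_subgraphs G k =
    {H. induced_subgraph H G \<and> isometric_subgraph H G \<and> Digraph_Component.connected H \<and> gdiameter H = enat k}"

end

theory Submission
  imports Defs "Graph_Theory.Digraph_Component_Vwalk"
begin

text \<open>
  A shortest path of an isometric subgraph \<open>H\<close> is a shortest path of \<open>G\<close>, and it is no longer
  than the diameter of \<open>H\<close>; so a mutual-visibility set of a member \<open>H\<close> of the family is a
  \<open>k\<close>-distance mutual-visibility set of \<open>G\<close>. For the maximum on the right-hand side to be
  meaningful, the family also has to be nonempty: it contains the graph induced by the first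
  \<open>k + 1\<close> vertices of a shortest path between two vertices at distance \<open>d\<close>.
\<close>

section \<open>Distances\<close>

lemma length_vwalk_to_vpath_le: "length (vwalk_to_vpath p) \<le> length p"
proof (induct p rule: vwalk_to_vpath_induct3)
  case (in_set x xs)
  then show ?case
    using length_dropWhile_le[of "\<lambda>y. y \<noteq> x" xs] by simp
qed auto

text \<open>\<open>gdist\<close> is an infimum over paths, but \<open>vwalk_to_vpath\<close> cuts
  the loops out of a walk and keeps its ends. Joined, reversed or sliced walks therefore bound
  distances without any check of distinctness.\<close>

lemma gdist_vwalk_le:
  assumes "vwalk p G"
  shows "gdist G (hd p) (last p) \<le> enat (vwalk_length p)"
proof -
  have "path_between G (hd p) (vwalk_to_vpath p) (last p)"
    using assms
    by (simp add: path_between_def vwalk_to_vpath_vpath vwalk_to_vpath_hd vwalk_to_vpath_last)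
  then have "gdist G (hd p) (last p) \<le> enat (vwalk_length (vwalk_to_vpath p))"
    unfolding gdist_def by (intro INF_lower) simp
  also have "\<dots> \<le> enat (vwalk_length p)"
    using length_vwalk_to_vpath_le[of p] by simp
  finally show ?thesis .
qed

lemma shortest_path_exists:
  assumes "gdist G x y \<noteq> \<infinity>"
  obtains p where "shortest_path G x p y"
proof -
  let ?L = "(\<lambda>p. enat (vwalk_length p)) ` {p. path_between G x p y}"
  \<comment> \<open>The infimum of the empty set is \<infinity>; a nonempty set of
    \<open>enat\<close> values attains its infimum.\<close>
  have "?L \<noteq> {}"
    using assms unfolding gdist_def by (metis Inf_enat_def)
  then have "Inf ?L \<in> ?L"
    unfolding Inf_enat_def by (auto intro: LeastI)
  then show ?thesis
    using that by (auto simp: shortest_path_def gdist_def)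
qed

lemma gdist_triangle: "gdist G x z \<le> gdist G x y + gdist G y z"
proof (cases "gdist G x y = \<infinity> \<or> gdist G y z = \<infinity>")
  case False
  then obtain p q where p: "shortest_path G x p y" and q: "shortest_path G y q z"
    using shortest_path_exists by metis
  then have walks: "vwalk p G" "vwalk q G" and join: "joinable p q"
    by (auto simp: shortest_path_def path_between_def)
  have "gdist G (hd (p \<oplus> q)) (last (p \<oplus> q)) \<le> enat (vwalk_length (p \<oplus> q))"
    using walks join by (intro gdist_vwalk_le vwalk_joinI_vwalk)
  also have "enat (vwalk_length (p \<oplus> q)) = enat (vwalk_length p) + enat (vwalk_length q)"
    unfolding vwalk_join_vwalk_length[OF join] by simp
  also have "\<dots> = gdist G x y + gdist G y z"
    using p q by (simp add: shortest_path_def del: vwalk_length_simp)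
  finally show ?thesis
    using p q join by (simp add: vwalk_join_hd vwalk_join_last shortest_path_def path_between_def)
qed auto

lemma gdist_le_symmetric:
  assumes "symmetric G"
  shows "gdist G y x \<le> gdist G x y"
proof (cases "gdist G x y = \<infinity>")
  case False
  then obtain p where p: "shortest_path G x p y"
    using shortest_path_exists by metis
  then have "vwalk p G"
    by (auto simp: shortest_path_def path_between_def)
  then have "vwalk (rev p) G"
    using assms by (auto simp: vwalk_def set_vwalk_arcs_rev symmetric_def dest: symD)
  from gdist_vwalk_le[OF this] show ?thesis
    using p \<open>vwalk p G\<close>
    by (auto simp: shortest_path_def path_between_def hd_rev last_rev vwalk_def)
qed simp

lemma gdist_antimono:
  assumes "subgraph H G"
  shows "gdist G x y \<le> gdist H x y"
  unfolding gdist_def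
  using assms by (intro INF_superset_mono) (auto simp: path_between_def intro: vpathI_subgraph)

lemma gdist_le_gdiameter:
  assumes "x \<in> verts G" "y \<in> verts G"
  shows "gdist G x y \<le> gdiameter G"
  unfolding gdiameter_def using assms by (intro SUP_upper2[where i = "(x, y)"]) auto

lemma vwalk_take:
  assumes "vwalk p G" "0 < n"
  shows "vwalk (take n p) G"
proof (rule vwalkI_append_l)
  show "vwalk (take n p @ drop n p) G"
    using assms(1) by simp
qed (use assms in auto)

lemma vwalk_drop:
  assumes "vwalk p G" "n < length p"
  shows "vwalk (drop n p) G"
proof (rule vwalkI_append_r)
  show "vwalk (take n p @ drop n p) G"
    using assms(1) by simp
qed (use assms in auto)

lemma gdist_nth_le:
  assumes "vwalk p G" "i \<le> j" "j < length p"
  shows "gdist G (p ! i) (p ! j) \<le> enat (j - i)"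
proof -
  define q where "q = drop i (take (Suc j) p)"
  have len: "length q = Suc (j - i)"
    using assms(2,3) by (simp add: q_def)
  have ends: "hd q = p ! i" "last q = p ! j"
    using assms(2,3) len by (auto simp: q_def hd_drop_conv_nth last_conv_nth)
  have "vwalk q G"
    unfolding q_def using assms by (intro vwalk_drop vwalk_take) auto
  from gdist_vwalk_le[OF this] show ?thesis
    by (simp add: ends len)
qed

text \<open>A shortcut between two vertices of a shortest path would shorten the whole path: its
  length is at most \<open>i\<close>, plus the distance of the two vertices, plus the length of the
  remaining piece after \<open>j\<close>.\<close>

lemma gdist_shortest_path_nth:
  assumes "shortest_path G x p y" "i \<le> j" "j < length p"
  shows "gdist G (p ! i) (p ! j) = enat (j - i)"
proof (rule antisym)
  have walk: "vwalk p G" and xy: "x = p ! 0" "y = p ! (length p - 1)"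
    and dist: "gdist G x y = enat (length p - 1)"
    using assms
    by (auto simp: shortest_path_def path_between_def hd_conv_nth last_conv_nth
      simp flip: length_greater_0_conv)
  show "gdist G (p ! i) (p ! j) \<le> enat (j - i)"
    using gdist_nth_le[OF walk] assms by simp
  have "enat (length p - 1) \<le> gdist G x (p ! i) + gdist G (p ! i) y"
    using gdist_triangle dist by metis
  also have "\<dots> \<le> gdist G x (p ! i) + (gdist G (p ! i) (p ! j) + gdist G (p ! j) y)"
    by (intro add_left_mono gdist_triangle)
  also have "\<dots> \<le> enat i + (gdist G (p ! i) (p ! j) + enat (length p - 1 - j))"
    using gdist_nth_le[OF walk, of 0 i] gdist_nth_le[OF walk, of j "length p - 1"] assms
    by (intro add_mono order_refl) (auto simp: xy)
  finally show "enat (j - i) \<le> gdist G (p ! i) (p ! j)"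
    using assms by (cases "gdist G (p ! i) (p ! j)") auto
qed

section \<open>The family of induced isometric subgraphs\<close>

text \<open>Both ends of each arc of the walk lie in \<open>set p\<close>, so inducing on this set
  deletes none of these arcs.\<close>

lemma vwalk_induce_subgraph:
  assumes "vwalk p G"
  shows "vwalk p (G \<restriction> set p)"
proof -
  have "set (vwalk_arcs p) \<subseteq> arcs_ends (G \<restriction> set p)"
  proof
    fix a assume a: "a \<in> set (vwalk_arcs p)"
    then have "a \<in> set p \<times> set p"
      by (rule arcs_in_vwalk_arcs)
    moreover have "a \<in> arcs_ends G"
      using assms a by (auto simp: vwalk_def)
    ultimately show "a \<in> arcs_ends (G \<restriction> set p)"
      by (auto simp: arcs_ends_conv)
  qed
  then show ?thesis
    using assms by (auto simp: vwalk_def)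
qed

lemma induced_isometric_subgraphs_nonempty:
  assumes "graph G" "gdiameter G = enat d" "k \<in> {1..d}"
  shows "induced_isometric_subgraphs G k \<noteq> {}"
proof -
  interpret graph G by fact
  \<comment> \<open>Since \<open>k\<close> is positive, exceeding \<open>k - 1\<close> means being
    at least \<open>k\<close>. A pair at distance at least \<open>k\<close> suffices, so the
    supremum need not be shown to be attained.\<close>
  have "enat (k - 1) < gdiameter G"
    using assms(2,3) by auto
  then obtain x y where xy: "x \<in> verts G" "y \<in> verts G" "enat (k - 1) < gdist G x y"
    by (auto simp: gdiameter_def less_SUP_iff)
  have "gdist G x y \<le> enat d"
    using gdist_le_gdiameter xy assms(2) by metis
  then have "gdist G x y \<noteq> \<infinity>"
    by (cases "gdist G x y") auto
  then obtain p where p: "shortest_path G x p y"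
    by (rule shortest_path_exists)
  then have walk: "vwalk p G" and "enat (length p - 1) = gdist G x y"
    by (auto simp: shortest_path_def path_between_def)
  then have "enat (k - 1) < enat (length p - 1)"
    using xy(3) by metis
  then have len: "k < length p"
    by simp
  \<comment> \<open>\<open>Suc k\<close> vertices, with indices from 0 to \<open>k\<close>, span
    exactly \<open>k\<close> edges.\<close>
  define q where "q = take (Suc k) p"
  have len_q: "length q = Suc k"
    using len by (simp add: q_def)
  have "vwalk q G"
    unfolding q_def using walk by (intro vwalk_take) auto
  define H where "H = G \<restriction> set q"
  have ind: "induced_subgraph H G"
    unfolding H_def using \<open>vwalk q G\<close> by (intro induced_induce) auto
  then have sub: "subgraph H G"
    by (rule induced_imp_subgraph)
  interpret H: sym_digraph H
    using ind by (rule induced_graph_imp_graph)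
  have vertsH: "verts H = set q"
    by (simp add: H_def)
  have walkH: "vwalk q H"
    unfolding H_def using \<open>vwalk q G\<close> by (rule vwalk_induce_subgraph)
  have dist_nth_G: "gdist G (q ! i) (q ! j) = enat (j - i)" if "i \<le> j" "j \<le> k" for i j
    using gdist_shortest_path_nth[OF p, of i j] that len by (simp add: q_def)
  \<comment> \<open>The segment of \<open>q\<close> lies in \<open>H\<close> and gives the upper
    bound; distances in a subgraph cannot be smaller than in \<open>G\<close>, which gives the lower
    bound.\<close>
  have dist_nth_H: "gdist H (q ! i) (q ! j) = enat (j - i)" if "i \<le> j" "j \<le> k" for i j
    using gdist_nth_le[OF walkH, of i j] gdist_antimono[OF sub, of "q ! i" "q ! j"]
      dist_nth_G[of i j] that len_q by simp
  \<comment> \<open>Stated for any graph so that it reduces the index order \<open>j < i\<close> to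
    the computed one in both \<open>G\<close> and \<open>H\<close>.\<close>
  have sym: "gdist G' u v = gdist G' v u" if "symmetric G'" for G' :: "('a, 'b) pre_digraph" and u v
    using that by (intro antisym gdist_le_symmetric)
  have dist_H: "gdist H u v = gdist G u v \<and> gdist H u v \<le> enat k"
    if uv: "u \<in> verts H" "v \<in> verts H" for u v
  proof -
    obtain i j where ij: "u = q ! i" "v = q ! j" "i \<le> k" "j \<le> k"
      using uv len_q by (auto simp: vertsH in_set_conv_nth less_Suc_eq_le)
    show ?thesis
    proof (cases "i \<le> j")
      case True
      then show ?thesis using ij dist_nth_G dist_nth_H by simp
    next
      case False
      then show ?thesis
        using ij dist_nth_G[of j i] dist_nth_H[of j i] sym[OF sym_arcs] sym[OF H.sym_arcs] by simp
    qed
  qed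
  have "gdiameter H = enat k"
  proof (rule antisym)
    show "gdiameter H \<le> enat k"
      unfolding gdiameter_def using dist_H by (auto intro!: SUP_least)
    \<comment> \<open>The two ends of \<open>q\<close> realize the diameter.\<close>
    have "q ! 0 \<in> verts H" "q ! k \<in> verts H"
      using len_q by (auto simp: vertsH)
    from gdist_le_gdiameter[OF this] show "enat k \<le> gdiameter H"
      by (simp add: dist_nth_H)
  qed
  moreover have "Digraph_Component.connected H"
  proof -
    have "\<exists>p. vwalk p H \<and> hd p = u \<and> last p = v" if "u \<in> verts H" "v \<in> verts H" for u v
    proof -
      have "gdist H u v \<noteq> \<infinity>"
        using dist_H[OF that] by (metis enat.distinct(1) infinity_ileE)
      then show ?thesis
        by (metis shortest_path_exists shortest_path_def path_between_def vpath_def)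
    qed
    \<comment> \<open>\<open>connected\<close> speaks of the symmetric closure, where reachability
      agrees with that in the already symmetric \<open>H\<close>.\<close>
    then have "u \<rightarrow>\<^sup>*\<^bsub>mk_symmetric H\<^esub> v" if "u \<in> verts H" "v \<in> verts H" for u v
      using that by (simp add: H.reachable_mk_symmetric_eq[OF H.sym_arcs] H.reachable_vwalk_conv)
    moreover have "verts H \<noteq> {}"
      using len_q by (auto simp: vertsH)
    ultimately show ?thesis
      by (auto simp: connected_def mk_symmetric_def)
  qed
  moreover have "isometric_subgraph H G"
    using sub dist_H by (simp add: isometric_subgraph_def)
  ultimately show ?thesis
    using ind by (auto simp: induced_isometric_subgraphs_def)
qed

text \<open>An induced subgraph is determined by its vertex set, and there are finitely many of
  these.\<close>

lemma finite_induced_isometric_subgraphs: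
  assumes "fin_digraph G"
  shows "finite (induced_isometric_subgraphs G k)"
proof (rule finite_subset)
  interpret fin_digraph G by fact
  show "induced_isometric_subgraphs G k \<subseteq> (\<lambda>S. G \<restriction> S) ` Pow (verts G)"
  proof
    fix H assume "H \<in> induced_isometric_subgraphs G k"
    then have "induced_subgraph H G"
      by (simp add: induced_isometric_subgraphs_def)
    then have "H = G \<restriction> verts H" "verts H \<subseteq> verts G"
      by (auto simp: induce_eq_iff_induced)
    then show "H \<in> (\<lambda>S. G \<restriction> S) ` Pow (verts G)"
      by blast
  qed
  show "finite ((\<lambda>S. G \<restriction> S) ` Pow (verts G))"
    by simp
qed

section \<open>Visibility\<close>

text \<open>The path survives in the larger graph, and isometry keeps its length equal to the
  distance of its ends.\<close>

lemma shortest_path_isometric_subgraph: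
  assumes "isometric_subgraph H G" "shortest_path H x p y"
  shows "shortest_path G x p y"
proof -
  have path: "vpath p H" "hd p = x" "last p = y"
    using assms(2) by (auto simp: shortest_path_def path_between_def)
  then have "x \<in> verts H" "y \<in> verts H"
    by (auto simp: vpath_def vwalk_def)
  then have "gdist H x y = gdist G x y"
    using assms(1) by (simp add: isometric_subgraph_def)
  moreover have "vpath p G"
    using path(1) assms(1) by (auto simp: isometric_subgraph_def intro: vpathI_subgraph)
  ultimately show ?thesis
    using assms(2) path by (simp add: shortest_path_def path_between_def)
qed

lemma k_distance_mutual_visibility_set_isometric:
  assumes iso: "isometric_subgraph H G" and diam: "gdiameter H = enat k"
    and S: "mutual_visibility_set H S"
  shows "k_distance_mutual_visibility_set G k S"
  unfolding k_distance_mutual_visibility_set_def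
proof (intro conjI ballI impI)
  show "S \<subseteq> verts G"
    using S iso subgraph_imp_subverts
    by (fastforce simp: mutual_visibility_set_def isometric_subgraph_def)
  fix x y assume xy: "x \<in> S" "y \<in> S" "x \<noteq> y"
  then obtain p where p: "shortest_path H x p y" "set p \<inter> S = {x, y}"
    using S unfolding mutual_visibility_set_def visible_def by metis
  have "x \<in> verts H" "y \<in> verts H"
    using xy S by (auto simp: mutual_visibility_set_def)
  \<comment> \<open>The length of \<open>p\<close> is a distance in \<open>H\<close>, hence bounded
    by the diameter of \<open>H\<close>.\<close>
  from gdist_le_gdiameter[OF this] have "enat (vwalk_length p) \<le> enat k"
    using p(1) diam by (metis shortest_path_def)
  then have "vwalk_length p \<le> k"
    by simp
  moreover have "internal_verts p \<inter> S = {}"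
    using p by (auto simp: internal_verts_def shortest_path_def path_between_def)
  ultimately show "k_visible G k S x y"
    using shortest_path_isometric_subgraph[OF iso p(1)] by (auto simp: k_visible_def)
qed

lemma mu_le_mu_k:
  assumes "finite (verts G)" "isometric_subgraph H G" "gdiameter H = enat k"
  shows "mu H \<le> mu_k k G"
  unfolding mu_def mu_k_def
proof (rule Max_mono)
  show "card ` {S. mutual_visibility_set H S} \<subseteq> card ` {S. k_distance_mutual_visibility_set G k S}"
    using k_distance_mutual_visibility_set_isometric assms(2,3) by blast
  \<comment> \<open>\<open>Max_mono\<close> requires the smaller set to be nonempty and the larger
    one to be finite; the empty set is vacuously a mutual-visibility set.\<close>
  have "mutual_visibility_set H {}"
    by (simp add: mutual_visibility_set_def)
  then show "card ` {S. mutual_visibility_set H S} \<noteq> {}"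
    by blast
  have "{S. k_distance_mutual_visibility_set G k S} \<subseteq> Pow (verts G)"
    by (auto simp: k_distance_mutual_visibility_set_def)
  then show "finite (card ` {S. k_distance_mutual_visibility_set G k S})"
    using assms(1) by (meson finite_Pow_iff finite_imageI finite_subset)
qed

theorem theorem2p1:
  fixes G :: "('a, 'b) pre_digraph" and d :: nat
  assumes "graph G" and "Digraph_Component.connected G" and "gdiameter G = enat d"
  shows "\<forall>k\<in>{1..d}. mu_k k G \<ge> Max (mu ` induced_isometric_subgraphs G k)"
proof
  fix k assume k: "k \<in> {1..d}"
  interpret graph G by fact
  have "mu H \<le> mu_k k G" if "H \<in> induced_isometric_subgraphs G k" for H
    using that by (auto simp: induced_isometric_subgraphs_def intro: mu_le_mu_k)
  \<comment> \<open>Over a finite nonempty family, bounding \<open>Max\<close> amounts to bounding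
    every member.\<close>
  then show "mu_k k G \<ge> Max (mu ` induced_isometric_subgraphs G k)"
    using induced_isometric_subgraphs_nonempty[OF assms(1,3) k]
      finite_induced_isometric_subgraphs[OF fin_digraph]
    by simp
qed

end
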